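(* Let $H$ be a finite $r$-uniform hypergraph on $n$ vertices and let $k\ge1$ be an integer. Then $f(H,1,k)=n-M(H,k-1)$.
   Context: An orientation $D$ of an $r$-uniform hypergraph $H$ assigns to each edge a linear ordering of its $r$ vertices (positions $1,\dots,r$). For a vertex $v$ and $1\le i\le r$, $\deg_i(v)$ is the number of edges in which $v$ occupies position $i$. $f(D,1,k)$ is the number of vertices $v$ with $\deg_i(v)\ge k$ for all $i=1,\dots,r$, and $f(H,1,k)$ is the minimum of $f(D,1,k)$ over all orientations $D$ of $H$. For $F\subseteq V(H)$, $e(F)$ is the number of edges contained in $F$; for $A\subseteq V(H)$ nonempty, ${\rm Mad}(A)=\max\{r\,e(F)/|F|:\emptyset\ne F\subseteq A\}$ (the maximum average degree of the induced subhypergraph $H[A]$; the empty set is considered to satisfy any upper bound on ${\rm Mad}$). For an integer $j$, $M(H,j)=\max|A_1\cup\dots\cup A_r|$, the maximum over all pairwise vertex-disjoint (possibly empty) sets $A_1,\dots,A_r\subseteq V(H)$ with ${\rm Mad}(A_i)\le rj$ for each $i$. *)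

theory Defs
  imports Complex_Main "HOL-Library.Disjoint_Sets"
begin

text \<open>A hypergraph is given by its vertex set \<open>V\<close> and its set of edges \<open>E\<close> (no repeated edges).\<close>

definition uniform_hypergraph :: "nat \<Rightarrow> 'a set \<Rightarrow> 'a set set \<Rightarrow> bool" where
  "uniform_hypergraph r V E \<longleftrightarrow> finite V \<and> (\<forall>e\<in>E. e \<subseteq> V \<and> card e = r)"

text \<open>A linear ordering of an edge is a list enumerating its vertices without repetition.
  Values of \<open>D\<close> outside \<open>E\<close> are irrelevant.\<close>

definition orientation :: "'a set set \<Rightarrow> ('a set \<Rightarrow> 'a list) \<Rightarrow> bool" where
  "orientation E D \<longleftrightarrow> (\<forall>e\<in>E. distinct (D e) \<and> set (D e) = e)"

text \<open>Positions are numbered from 1, list indices from 0.\<close>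

definition pos_deg :: "'a set set \<Rightarrow> ('a set \<Rightarrow> 'a list) \<Rightarrow> nat \<Rightarrow> 'a \<Rightarrow> nat" where
  "pos_deg E D i v = card {e \<in> E. D e ! (i - 1) = v}"

text \<open>\<open>f_orient\<close> and \<open>f_hyp\<close> are $f(D,1,k)$ and $f(H,1,k)$.\<close>

definition f_orient ::
    "nat \<Rightarrow> 'a set \<Rightarrow> 'a set set \<Rightarrow> ('a set \<Rightarrow> 'a list) \<Rightarrow> nat \<Rightarrow> nat" where
  "f_orient r V E D k = card {v \<in> V. \<forall>i\<in>{1..r}. pos_deg E D i v \<ge> k}"

definition f_hyp :: "nat \<Rightarrow> 'a set \<Rightarrow> 'a set set \<Rightarrow> nat \<Rightarrow> nat" where
  "f_hyp r V E k = Min {f_orient r V E D k | D. orientation E D}"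

definition edges_in :: "'a set set \<Rightarrow> 'a set \<Rightarrow> nat" where
  "edges_in E F = card {e \<in> E. e \<subseteq> F}"

text \<open>\<open>Mad\<close> is meaningful only for finite nonempty \<open>A\<close>; \<open>Mad_le\<close> adds the convention that
  the empty set satisfies every upper bound.\<close>

definition Mad :: "nat \<Rightarrow> 'a set set \<Rightarrow> 'a set \<Rightarrow> real" where
  "Mad r E A = Max {real r * real (edges_in E F) / real (card F) | F. F \<noteq> {} \<and> F \<subseteq> A}"

definition Mad_le :: "nat \<Rightarrow> 'a set set \<Rightarrow> 'a set \<Rightarrow> real \<Rightarrow> bool" where
  "Mad_le r E A c \<longleftrightarrow> A = {} \<or> Mad r E A \<le> c"

definition admissible ::
    "nat \<Rightarrow> 'a set \<Rightarrow> 'a set set \<Rightarrow> int \<Rightarrow> (nat \<Rightarrow> 'a set) \<Rightarrow> bool" where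
  "admissible r V E j A \<longleftrightarrow>
     disjoint_family_on A {1..r} \<and>
     (\<forall>i\<in>{1..r}. A i \<subseteq> V \<and> Mad_le r E (A i) (real r * real_of_int j))"

definition M_hyp :: "nat \<Rightarrow> 'a set \<Rightarrow> 'a set set \<Rightarrow> int \<Rightarrow> nat" where
  "M_hyp r V E j = Max {card (\<Union>i\<in>{1..r}. A i) | A. admissible r V E j A}"

text \<open>The sets under \<open>Min\<close> and \<open>Max\<close> above are finite and nonempty.\<close>

lemma f_hyp_set:
  assumes "uniform_hypergraph r V E"
  shows "finite {f_orient r V E D k | D. orientation E D}"
    and "{f_orient r V E D k | D. orientation E D} \<noteq> {}"
proof -
  have V: "finite V" using assms by (simp add: uniform_hypergraph_def)
  have "{f_orient r V E D k | D. orientation E D} \<subseteq> {..card V}"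
    using V by (auto simp: f_orient_def intro!: card_mono)
  then show "finite {f_orient r V E D k | D. orientation E D}"
    by (rule finite_subset) simp
  have "\<exists>xs. distinct xs \<and> set xs = e" if "e \<in> E" for e
    using finite_distinct_list[of e] assms V that
    by (meson uniform_hypergraph_def finite_subset)
  then obtain D where "\<forall>e\<in>E. distinct (D e) \<and> set (D e) = e" by metis
  then show "{f_orient r V E D k | D. orientation E D} \<noteq> {}"
    by (auto simp: orientation_def)
qed

lemma Mad_set:
  assumes "finite A" "A \<noteq> {}"
  shows "finite {real r * real (edges_in E F) / real (card F) | F. F \<noteq> {} \<and> F \<subseteq> A}"
    and "{real r * real (edges_in E F) / real (card F) | F. F \<noteq> {} \<and> F \<subseteq> A} \<noteq> {}"
proof -
  have "{real r * real (edges_in E F) / real (card F) | F. F \<noteq> {} \<and> F \<subseteq> A}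
      \<subseteq> (\<lambda>F. real r * real (edges_in E F) / real (card F)) ` Pow A" by auto
  then show "finite {real r * real (edges_in E F) / real (card F) | F. F \<noteq> {} \<and> F \<subseteq> A}"
    using assms(1) by (meson finite_Pow_iff finite_imageI finite_subset)
  show "{real r * real (edges_in E F) / real (card F) | F. F \<noteq> {} \<and> F \<subseteq> A} \<noteq> {}"
    using assms(2) by auto
qed

lemma M_hyp_set:
  assumes "finite V"
  shows "finite {card (\<Union>i\<in>{1..r}. A i) | A. admissible r V E j A}"
    and "{card (\<Union>i\<in>{1..r}. A i) | A. admissible r V E j A} \<noteq> {}"
proof -
  have "card (\<Union>i\<in>{1..r}. A i) \<le> card V" if "admissible r V E j A" for A
    using that assms by (intro card_mono) (auto simp: admissible_def)
  then have "{card (\<Union>i\<in>{1..r}. A i) | A. admissible r V E j A} \<subseteq> {..card V}"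
    by blast
  then show "finite {card (\<Union>i\<in>{1..r}. A i) | A. admissible r V E j A}"
    by (rule finite_subset) simp
  have "admissible r V E j (\<lambda>_. {})"
    by (simp add: admissible_def Mad_le_def disjoint_family_on_def)
  then show "{card (\<Union>i\<in>{1..r}. A i) | A. admissible r V E j A} \<noteq> {}"
    by blast
qed

end

theory Submission imports Defs begin

text \<open>
  For \<open>r > 0\<close>, the bound \<open>Mad(A) \<le> r j\<close> says \<open>e(F) \<le> j |F|\<close> for every \<open>F \<subseteq> A\<close>. Given an
  orientation, sort each vertex failing the degree condition into a class \<open>A\<^sub>i\<close> for some \<open>i\<close>
  with \<open>deg\<^sub>i < k\<close>; an edge inside \<open>F \<subseteq> A\<^sub>i\<close> has its \<open>i\<close>-th vertex in \<open>F\<close>, so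
  \<open>e(F) \<le> (k - 1) |F|\<close>. Conversely, given sparse disjoint classes \<open>A\<^sub>i\<close>, Hall's theorem assigns to
  every edge inside \<open>A\<^sub>i\<close> one of its vertices so that no vertex is used more than \<open>k - 1\<close> times.
  A second application of Hall's theorem orders each edge so that its \<open>i\<close>-th vertex lies outside
  \<open>A\<^sub>i\<close>, unless the edge is contained in \<open>A\<^sub>i\<close> and this vertex is the assigned one.
\<close>

section \<open>Hall's marriage theorem\<close>

text \<open>Induction on the number of indices. If some nonempty proper \<open>J\<close> is tight,
  match \<open>J\<close> inside its union \<open>U\<close> and the remaining indices outside
  \<open>U\<close>. Otherwise every nonempty proper subfamily has a surplus element, so fixing any
  \<open>x\<close> for any one index leaves Hall's condition intact for the others.\<close>

theorem hall_marriage: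
  fixes A :: "'i \<Rightarrow> 'b set"
  assumes "finite I" "\<And>i. i \<in> I \<Longrightarrow> finite (A i)"
    and "\<And>J. J \<subseteq> I \<Longrightarrow> card J \<le> card (\<Union>(A ` J))"
  shows "\<exists>R. inj_on R I \<and> (\<forall>i\<in>I. R i \<in> A i)"
  using assms
proof (induction "card I" arbitrary: I A rule: less_induct)
  case less
  note fin = less.prems(1) and finA = less.prems(2) and hall = less.prems(3)
  show ?case
  proof (cases "\<exists>J. J \<subset> I \<and> J \<noteq> {} \<and> card (\<Union>(A ` J)) = card J")
    case True
    then obtain J where J: "J \<subset> I" "J \<noteq> {}" "card (\<Union>(A ` J)) = card J" by blast
    define U where "U = \<Union>(A ` J)"
    have finJ: "finite J" using J fin by (meson finite_subset psubsetE)
    have finU: "finite U" using finJ J finA by (auto simp: U_def)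
    have "\<exists>R. inj_on R J \<and> (\<forall>i\<in>J. R i \<in> A i)"
    proof (rule less.hyps)
      show "card J < card I" using J fin psubset_card_mono by blast
    qed (use finJ J finA hall in auto)
    then obtain R1 where R1: "inj_on R1 J" "\<forall>i\<in>J. R1 i \<in> A i" by blast
    have "\<exists>R. inj_on R (I - J) \<and> (\<forall>i\<in>I - J. R i \<in> A i - U)"
    proof (rule less.hyps)
      show "card (I - J) < card I" using J fin by (intro psubset_card_mono) auto
    next
      fix K assume K: "K \<subseteq> I - J"
      have finK: "finite K" using K fin by (meson Diff_subset finite_subset)
      \<comment> \<open>Hall's condition for \<open>K\<close> after deleting \<open>U\<close>: apply
        it to \<open>K\<close> together with \<open>J\<close>; tightness makes \<open>card U\<close>
        cancel against \<open>card J\<close>.\<close>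
      have "card K + card J = card (K \<union> J)"
        using K finK finJ by (subst card_Un_disjoint) auto
      also have "\<dots> \<le> card (\<Union>(A ` (K \<union> J)))" using K J by (intro hall) auto
      also have "\<Union>(A ` (K \<union> J)) = (\<Union>i\<in>K. A i - U) \<union> U" by (auto simp: U_def)
      also have "card \<dots> \<le> card (\<Union>i\<in>K. A i - U) + card U" by (rule card_Un_le)
      finally show "card K \<le> card (\<Union>i\<in>K. A i - U)" using J by (simp add: U_def)
    qed (use fin finA in auto)
    then obtain R2 where R2: "inj_on R2 (I - J)" "\<forall>i\<in>I - J. R2 i \<in> A i - U" by blast
    have R1U: "\<forall>i\<in>J. R1 i \<in> U" using R1 by (auto simp: U_def)
    show ?thesis
    proof (intro exI conjI)
      show "inj_on (\<lambda>i. if i \<in> J then R1 i else R2 i) I"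
        using R1(1) R2 R1U unfolding inj_on_def by (metis DiffD2 DiffI)
    qed (use R1 R2 in auto)
  next
    case False
    show ?thesis
    proof (cases "I = {}")
      case nonempty: False
      then obtain i where i: "i \<in> I" by blast
      have "A i \<noteq> {}" using hall[of "{i}"] i by auto
      then obtain x where x: "x \<in> A i" by blast
      have "\<exists>R. inj_on R (I - {i}) \<and> (\<forall>j\<in>I - {i}. R j \<in> A j - {x})"
      proof (rule less.hyps)
        show "card (I - {i}) < card I" using i fin by (intro psubset_card_mono) auto
      next
        fix K assume K: "K \<subseteq> I - {i}"
        show "card K \<le> card (\<Union>j\<in>K. A j - {x})"
        proof (cases "K = {}")
          case ne: False
          have "card K \<le> card (\<Union>(A ` K))" using K by (intro hall) auto
          moreover have "card (\<Union>(A ` K)) \<noteq> card K" using False ne K i by blast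
          moreover have "card (\<Union>(A ` K)) - 1 \<le> card (\<Union>(A ` K) - {x})"
            by (simp add: card_Diff_singleton_if)
          ultimately have "card K \<le> card (\<Union>(A ` K) - {x})" by linarith
          then show ?thesis by (simp only: UN_extend_simps)
        qed simp
      qed (use fin finA in auto)
      then obtain R where "inj_on R (I - {i})" "\<forall>j\<in>I - {i}. R j \<in> A j - {x}" by blast
      then have "inj_on (R(i := x)) I \<and> (\<forall>j\<in>I. (R(i := x)) j \<in> A j)"
        using x i by (auto simp: inj_on_def)
      then show ?thesis by blast
    qed simp
  qed
qed

section \<open>Two applications of Hall's theorem to edges\<close>

text \<open>Give every vertex \<open>m\<close> copies \<open>(v, c)\<close> with
  \<open>c < m\<close> and match edges injectively to copies of their vertices. Hall's condition for
  a set \<open>J\<close> of edges is sparsity of the vertex set it covers.\<close>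

lemma bounded_load_assignment:
  assumes finE: "finite E" "\<And>e. e \<in> E \<Longrightarrow> finite e" "{} \<notin> E"
    and sparse: "\<And>F. F \<noteq> {} \<Longrightarrow> F \<subseteq> A \<Longrightarrow> edges_in E F \<le> m * card F"
  shows "\<exists>g. (\<forall>e\<in>E. e \<subseteq> A \<longrightarrow> g e \<in> e) \<and> (\<forall>v. card {e \<in> E. e \<subseteq> A \<and> g e = v} \<le> m)"
proof -
  define I where "I = {e \<in> E. e \<subseteq> A}"
  have "\<exists>R. inj_on R I \<and> (\<forall>e\<in>I. R e \<in> e \<times> {..<m})"
  proof (rule hall_marriage)
    fix J assume J: "J \<subseteq> I"
    show "card J \<le> card (\<Union>e\<in>J. e \<times> {..<m})"
    proof (cases "J = {}")
      case False
      have "card J \<le> edges_in E (\<Union>J)"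
        unfolding edges_in_def using J finE by (intro card_mono) (auto simp: I_def)
      also have "\<dots> \<le> m * card (\<Union>J)"
      proof (rule sparse)
        obtain e where "e \<in> J" using False by blast
        moreover from this have "e \<noteq> {}" using J finE(3) by (auto simp: I_def)
        ultimately show "\<Union>J \<noteq> {}" by blast
      qed (use J in \<open>auto simp: I_def\<close>)
      also have "\<dots> = card (\<Union>J \<times> {..<m})" by (simp add: card_cartesian_product)
      also have "\<Union>J \<times> {..<m} = (\<Union>e\<in>J. e \<times> {..<m})" by auto
      finally show ?thesis .
    qed simp
  qed (use finE in \<open>auto simp: I_def\<close>)
  then obtain R where R: "inj_on R I" "\<forall>e\<in>I. R e \<in> e \<times> {..<m}" by blast
  \<comment> \<open>Edges sent to the same vertex use different copies of it, so their second
    components are distinct numbers below \<open>m\<close>.\<close>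
  have "card {e \<in> I. fst (R e) = v} \<le> card {..<m}" for v
  proof (rule card_inj_on_le)
    show "inj_on (\<lambda>e. snd (R e)) {e \<in> I. fst (R e) = v}"
      using R(1) by (auto simp: inj_on_def prod_eq_iff)
  qed (use R in auto)
  then show ?thesis
    using R by (intro exI[of _ "\<lambda>e. fst (R e)"]) (auto simp: I_def mem_Times_iff)
qed

text \<open>Match positions to permitted vertices. One position has a choice because
  \<open>B i\<close> is a proper subset of \<open>e\<close>; two positions together already permit
  all of \<open>e\<close>, because a vertex lies in at most one \<open>B i\<close>, and there are
  only \<open>r\<close> positions.\<close>

lemma ordering_avoiding_disjoint_sets:
  assumes e: "finite e" "card e = r"
    and B: "\<And>i. i \<in> {1..r} \<Longrightarrow> B i \<subset> e" "disjoint_family_on B {1..r}"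
  shows "\<exists>xs. distinct xs \<and> set xs = e \<and> (\<forall>i\<in>{1..r}. xs ! (i - 1) \<notin> B i)"
proof -
  have "\<exists>R. inj_on R {1..r} \<and> (\<forall>i\<in>{1..r}. R i \<in> e - B i)"
  proof (rule hall_marriage)
    fix J assume J: "J \<subseteq> {1..r}"
    have finJ: "finite J" using J finite_subset by blast
    consider "J = {}" | i where "J = {i}" | i j where "i \<in> J" "j \<in> J" "i \<noteq> j"
      by blast
    then show "card J \<le> card (\<Union>i\<in>J. e - B i)"
    proof cases
      case (2 i)
      then have "e - B i \<noteq> {}" using B(1)[of i] J by auto
      then show ?thesis using e 2 by (simp add: Suc_le_eq card_gt_0_iff)
    next
      case (3 i j)
      then have "B i \<inter> B j = {}" using B(2) J by (auto simp: disjoint_family_on_def)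
      then have "(\<Union>i\<in>J. e - B i) = e" using 3 by blast
      then show ?thesis using card_mono[OF _ J] e by simp
    qed simp
  qed (use e in auto)
  then obtain R where R: "inj_on R {1..r}" "\<forall>i\<in>{1..r}. R i \<in> e - B i" by blast
  \<comment> \<open>An injection from \<open>r\<close> positions into a set of size \<open>r\<close>
    is onto, so the resulting list enumerates \<open>e\<close>.\<close>
  have img: "R ` {1..r} = e"
    using R e by (intro card_subset_eq) (auto simp: card_image)
  have "set [1..<Suc r] = {1..r}" by auto
  then have "distinct (map R [1..<Suc r])" "set (map R [1..<Suc r]) = e"
    using R(1) img by (simp_all only: distinct_map distinct_upt set_map simp_thms)
  moreover have "\<forall>i\<in>{1..r}. map R [1..<Suc r] ! (i - 1) \<notin> B i"
    using R(2) by (auto simp del: upt_Suc)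
  ultimately show ?thesis by blast
qed

section \<open>The density bound as an edge count\<close>

lemma Mad_le_iff_sparse:
  assumes "finite A" "r > 0"
  shows "Mad_le r E A (real r * real m) \<longleftrightarrow>
    (\<forall>F. F \<noteq> {} \<and> F \<subseteq> A \<longrightarrow> edges_in E F \<le> m * card F)"
proof (cases "A = {}")
  case False
  have eq: "real r * real (edges_in E F) / real (card F) \<le> real r * real m
      \<longleftrightarrow> edges_in E F \<le> m * card F" if "F \<noteq> {}" "F \<subseteq> A" for F
  proof -
    have "card F > 0" using that assms finite_subset card_gt_0_iff by blast
    then have "real r * real (edges_in E F) / real (card F) \<le> real r * real m
      \<longleftrightarrow> real (edges_in E F) \<le> real (m * card F)"
      using assms by (simp add: divide_le_eq mult.assoc)
    then show ?thesis by (simp only: of_nat_le_iff)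
  qed
  have "Mad_le r E A (real r * real m) \<longleftrightarrow>
      (\<forall>F. F \<noteq> {} \<and> F \<subseteq> A \<longrightarrow> real r * real (edges_in E F) / real (card F) \<le> real r * real m)"
    unfolding Mad_le_def Mad_def using False
    by (subst Max_le_iff[OF Mad_set(1)[OF assms(1) False] Mad_set(2)[OF assms(1) False]]) auto
  then show ?thesis using eq by blast
qed (simp add: Mad_le_def)

lemma admissible_iff_sparse:
  assumes "finite V" "r > 0"
  shows "admissible r V E (int m) A \<longleftrightarrow>
    disjoint_family_on A {1..r} \<and>
    (\<forall>i\<in>{1..r}. A i \<subseteq> V \<and> (\<forall>F. F \<noteq> {} \<and> F \<subseteq> A i \<longrightarrow> edges_in E F \<le> m * card F))"
proof -
  have "A i \<subseteq> V \<and> Mad_le r E (A i) (real r * real m) \<longleftrightarrow>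
      A i \<subseteq> V \<and> (\<forall>F. F \<noteq> {} \<and> F \<subseteq> A i \<longrightarrow> edges_in E F \<le> m * card F)" for i
    using Mad_le_iff_sparse[OF _ assms(2)] finite_subset[OF _ assms(1)] by blast
  then show ?thesis unfolding admissible_def by (simp only: of_int_of_nat_eq)
qed

section \<open>Orientations versus admissible families\<close>

lemma uniform_hypergraph_finite_edges:
  assumes "uniform_hypergraph r V E"
  shows "finite E"
  using assms finite_subset[of E "Pow V"] by (auto simp: uniform_hypergraph_def)

lemma edges_in_le_if_pos_deg_le:
  assumes "uniform_hypergraph r V E" "orientation E D" "i \<in> {1..r}" "finite F"
    and deg: "\<And>v. v \<in> F \<Longrightarrow> pos_deg E D i v \<le> m"
  shows "edges_in E F \<le> m * card F"
proof -
  have finE: "finite E" using assms(1) by (rule uniform_hypergraph_finite_edges)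
  have "D e ! (i - 1) \<in> e" if "e \<in> E" for e
  proof -
    have "distinct (D e)" "set (D e) = e" "card e = r"
      using assms(1,2) that by (auto simp: orientation_def uniform_hypergraph_def)
    then have "i - 1 < length (D e)" using assms(3) distinct_card[of "D e"] by auto
    then show ?thesis using \<open>set (D e) = e\<close> nth_mem by blast
  qed
  then have "edges_in E F \<le> card (\<Union>v\<in>F. {e \<in> E. D e ! (i - 1) = v})"
    unfolding edges_in_def using finE assms(4) by (intro card_mono) auto
  also have "\<dots> \<le> (\<Sum>v\<in>F. pos_deg E D i v)"
    unfolding pos_deg_def using assms(4) by (rule card_UN_le)
  also have "\<dots> \<le> (\<Sum>v\<in>F. m)" by (intro sum_mono deg)
  finally show ?thesis by (simp add: mult.commute)
qed

lemma ex_admissible_for_orientation: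
  assumes H: "uniform_hypergraph r V E" and "r > 0" and D: "orientation E D"
  shows "\<exists>A. admissible r V E (int m) A \<and>
    card V = f_orient r V E D (Suc m) + card (\<Union>i\<in>{1..r}. A i)"
proof -
  have finV: "finite V" using H by (simp add: uniform_hypergraph_def)
  define G where "G = {v \<in> V. \<forall>i\<in>{1..r}. pos_deg E D i v \<ge> Suc m}"
  have "\<forall>v\<in>V - G. \<exists>i\<in>{1..r}. pos_deg E D i v \<le> m"
    by (auto simp: G_def not_less_eq_eq)
  \<comment> \<open>A vertex may fail at several positions; \<open>c\<close> selects one of them,
    which makes the classes disjoint while still covering all of \<open>V - G\<close>.\<close>
  then obtain c where c: "\<forall>v\<in>V - G. c v \<in> {1..r} \<and> pos_deg E D (c v) v \<le> m" by metis
  define A where "A i = {v \<in> V - G. c v = i}" for i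
  have "edges_in E F \<le> m * card F" if "i \<in> {1..r}" "F \<subseteq> A i" for i F
    using that c finite_subset[OF _ finV, of F]
    by (intro edges_in_le_if_pos_deg_le[OF H D that(1)]) (auto simp: A_def)
  then have "admissible r V E (int m) A"
    by (auto simp: admissible_iff_sparse[OF finV assms(2)] A_def disjoint_family_on_def)
  moreover have "(\<Union>i\<in>{1..r}. A i) = V - G" using c by (auto simp: A_def)
  moreover have "card V = card G + card (V - G)"
    using finV by (simp add: G_def card_Diff_subset card_mono)
  ultimately show ?thesis by (auto simp: G_def f_orient_def)
qed

text \<open>Only an inequality, since vertices outside all classes may fail the degree condition as
  well.\<close>

lemma ex_orientation_for_admissible:
  assumes H: "uniform_hypergraph r V E" and "r > 0" and A: "admissible r V E (int m) A"
  shows "\<exists>D. orientation E D \<and>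
    f_orient r V E D (Suc m) + card (\<Union>i\<in>{1..r}. A i) \<le> card V"
proof -
  have finV: "finite V" and E: "\<And>e. e \<in> E \<Longrightarrow> finite e \<and> card e = r"
    using H finite_subset by (auto simp: uniform_hypergraph_def)
  have finE: "finite E" using H by (rule uniform_hypergraph_finite_edges)
  have neE: "{} \<notin> E" using E \<open>r > 0\<close> by fastforce
  have disj: "disjoint_family_on A {1..r}" and AV: "\<And>i. i \<in> {1..r} \<Longrightarrow> A i \<subseteq> V"
    and sparse: "\<And>i F. \<lbrakk>i \<in> {1..r}; F \<noteq> {}; F \<subseteq> A i\<rbrakk> \<Longrightarrow> edges_in E F \<le> m * card F"
    using A by (auto simp: admissible_iff_sparse[OF finV assms(2)])
  have "\<forall>i\<in>{1..r}. \<exists>g. (\<forall>e\<in>E. e \<subseteq> A i \<longrightarrow> g e \<in> e) \<and>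
      (\<forall>v. card {e \<in> E. e \<subseteq> A i \<and> g e = v} \<le> m)"
    using finE E neE sparse by (intro ballI bounded_load_assignment) auto
  then obtain g where g: "\<And>i e. \<lbrakk>i \<in> {1..r}; e \<in> E; e \<subseteq> A i\<rbrakk> \<Longrightarrow> g i e \<in> e"
    and load: "\<And>i v. i \<in> {1..r} \<Longrightarrow> card {e \<in> E. e \<subseteq> A i \<and> g i e = v} \<le> m"
    by metis
  \<comment> \<open>The vertices of \<open>e\<close> forbidden at position \<open>i\<close>: those
    in \<open>A i\<close>, except the assigned vertex when \<open>e\<close> lies inside
    \<open>A i\<close>. Either way some vertex of \<open>e\<close> stays permitted, and disjointness
    is inherited from \<open>A\<close>.\<close>
  define B where "B e i = (if e \<subseteq> A i then e - {g i e} else e \<inter> A i)" for e i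
  have "\<exists>xs. distinct xs \<and> set xs = e \<and> (\<forall>i\<in>{1..r}. xs ! (i - 1) \<notin> B e i)"
    if "e \<in> E" for e
  proof (rule ordering_avoiding_disjoint_sets)
    show "B e i \<subset> e" if "i \<in> {1..r}" for i
      using g[OF that \<open>e \<in> E\<close>] by (auto simp: B_def)
    have "B e i \<subseteq> A i" for i by (auto simp: B_def)
    then show "disjoint_family_on (B e) {1..r}"
      using disj unfolding disjoint_family_on_def by blast
  qed (use E that in auto)
  then obtain D where D: "\<And>e. e \<in> E \<Longrightarrow> distinct (D e) \<and> set (D e) = e"
    and avoid: "\<And>e i. \<lbrakk>e \<in> E; i \<in> {1..r}\<rbrakk> \<Longrightarrow> D e ! (i - 1) \<notin> B e i"
    by metis
  have deg: "pos_deg E D i v \<le> m" if i: "i \<in> {1..r}" and v: "v \<in> A i" for i v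
  proof -
    \<comment> \<open>A vertex of \<open>A i\<close> that occupies position \<open>i\<close> escapes
      \<open>B e i\<close> only as the assigned vertex, so the load bound limits its degree
      there.\<close>
    have "e \<subseteq> A i \<and> g i e = v" if e: "e \<in> E" and eq: "D e ! (i - 1) = v" for e
    proof -
      have "i - 1 < length (D e)" using D[OF e] E[OF e] i distinct_card[of "D e"] by auto
      then have "v \<in> e" using D[OF e] eq nth_mem by blast
      then show ?thesis
        using avoid[OF e i] v eq by (auto simp: B_def split: if_splits)
    qed
    then have "pos_deg E D i v \<le> card {e \<in> E. e \<subseteq> A i \<and> g i e = v}"
      unfolding pos_deg_def using finE by (intro card_mono) auto
    then show ?thesis using load[OF i, of v] by linarith
  qed
  define G where "G = {v \<in> V. \<forall>i\<in>{1..r}. pos_deg E D i v \<ge> Suc m}"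
  have "G \<inter> (\<Union>i\<in>{1..r}. A i) = {}"
  proof -
    have "v \<notin> G" if "i \<in> {1..r}" "v \<in> A i" for i v
      using deg[OF that] that(1) not_less_eq_eq unfolding G_def by blast
    then show ?thesis by blast
  qed
  moreover have "G \<union> (\<Union>i\<in>{1..r}. A i) \<subseteq> V" using AV unfolding G_def by blast
  ultimately have "card G + card (\<Union>i\<in>{1..r}. A i) \<le> card V"
    using finV by (metis card_Un_disjoint card_mono finite_Un finite_subset)
  then show ?thesis using D by (auto simp: orientation_def f_orient_def G_def)
qed

theorem theorem2:
  fixes V :: "'a set" and E :: "'a set set" and r n k :: nat
  assumes "uniform_hypergraph r V E"
    and "card V = n"
    and "k \<ge> 1"
  shows "int (f_hyp r V E k) = int n - int (M_hyp r V E (int k - 1))"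
proof -
  obtain m where k: "k = Suc m" using \<open>k \<ge> 1\<close> by (cases k) auto
  then have j: "int k - 1 = int m" by simp
  have finV: "finite V" using assms(1) by (simp add: uniform_hypergraph_def)
  note fset = f_hyp_set[OF assms(1), of k]
    and Mset = M_hyp_set[OF finV, of r E "int m"]
  obtain D where D: "orientation E D" "f_hyp r V E k = f_orient r V E D k"
    using Min_in[OF fset] by (auto simp: f_hyp_def)
  obtain A where A: "admissible r V E (int m) A"
      "M_hyp r V E (int m) = card (\<Union>i\<in>{1..r}. A i)"
    using Max_in[OF Mset] by (auto simp: M_hyp_def)
  have "f_hyp r V E k + M_hyp r V E (int m) = n"
  \<comment> \<open>For \<open>r = 0\<close> there are no positions: every vertex counts as good and
    the union of the classes is empty.\<close>
  proof (cases "r = 0")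
    case True
    then show ?thesis using D A assms(2) by (simp add: f_orient_def)
  next
    case False
    \<comment> \<open>The minimizing \<open>D\<close> yields \<open>A'\<close> and hence
      \<open>n\<close> at most the sum; the maximizing \<open>A\<close> yields \<open>D'\<close> and
      hence the reverse inequality.\<close>
    obtain A' where A': "admissible r V E (int m) A'"
        "card V = f_orient r V E D k + card (\<Union>i\<in>{1..r}. A' i)"
      using ex_admissible_for_orientation[OF assms(1) _ D(1), of m] False k by auto
    have "card (\<Union>i\<in>{1..r}. A' i) \<le> M_hyp r V E (int m)"
      unfolding M_hyp_def using A' by (intro Max_ge[OF Mset(1)]) auto
    moreover obtain D' where D': "orientation E D'"
        "f_orient r V E D' k + card (\<Union>i\<in>{1..r}. A i) \<le> card V"
      using ex_orientation_for_admissible[OF assms(1) _ A(1)] False k by auto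
    moreover have "f_hyp r V E k \<le> f_orient r V E D' k"
      unfolding f_hyp_def using D' by (intro Min_le[OF fset(1)]) auto
    ultimately show ?thesis using A' D A assms(2) by linarith
  qed
  then show ?thesis unfolding j by linarith
qed

end
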